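(* The parameter tiling $T$ is aperiodic; that is, there is no non-zero vector $(a,b)\in\mathbb{N}_0^2$ such that $T(x+a,y+b)=T(x,y)$ for all $x,y\in\mathbb{N}$.
   Context: $\mathbb{N}$ denotes the positive integers and $\mathbb{N}_0=\mathbb{N}\cup\{0\}$. $V$ is the set of positive integers whose last non-zero digit in base $4$ is $1$ or $3$, and $D=\mathbb{N}\setminus V$. The function $c:\mathbb{N}\to\{0,1\}$ is $c(n)=1$ if $n\in V$ and $c(n)=0$ if $n\in D$. The parameter tiling $T:\mathbb{N}^2\to\{0,1\}$ is defined by $T(x,y)=1$ if $c(x)\neq c(y)$ and $T(x,y)=0$ if $c(x)=c(y)$. *)

theory Defs
  imports Main
begin

definition base4_digit :: "nat \<Rightarrow> nat \<Rightarrow> nat" where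
  "base4_digit n k = (n div 4 ^ k) mod 4"

(* Digits are indexed from the least significant one, so the last non-zero digit
   is the one at the least index carrying a non-zero digit. The value is
   unspecified at n = 0, which is never used. *)
definition last_nonzero_digit4 :: "nat \<Rightarrow> nat" where
  "last_nonzero_digit4 n = base4_digit n (LEAST k. base4_digit n k \<noteq> 0)"

definition V :: "nat set" where
  "V = {n. n > 0 \<and> last_nonzero_digit4 n \<in> {1, 3}}"

definition D :: "nat set" where
  "D = {n. n > 0} - V"

(* colour and parameter_tiling are meaningful on positive arguments only, where
   the else branch of colour is the case n : D; their values at 0 are junk. *)
definition colour :: "nat \<Rightarrow> nat" where
  "colour n = (if n \<in> V then 1 else 0)"

definition parameter_tiling :: "nat \<Rightarrow> nat \<Rightarrow> nat" where
  "parameter_tiling x y = (if colour x \<noteq> colour y then 1 else 0)"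

end

theory Submission
  imports Defs
begin

text \<open>
  The colour of a positive integer \<open>n\<close> is \<open>1\<close> exactly when the exponent of \<open>2\<close> in \<open>n\<close> is
  even, so doubling a number always changes its colour (\<open>colour_double\<close>).  No function
  \<open>c\<close> with this property has a period \<open>p > 0\<close>, since a period would give
  \<open>c (2 * p) = c (p + p) = c p\<close>.

  A period \<open>(a, b)\<close> of the tiling is ruled out in this way.  As \<open>T x y\<close> is the sum of the
  two colours modulo \<open>2\<close>, periodicity says that the shift by \<open>a\<close> changes the colour of \<open>x\<close>
  if and only if the shift by \<open>b\<close> changes the colour of \<open>y\<close>.  The two sides depend on
  independent variables, so each of the shifts either preserves every colour or reverses
  every colour.  In both cases applying the shift twice preserves every colour, so
  \<open>2 * a\<close> and \<open>2 * b\<close> would be periods of the colouring unless they vanish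
  (\<open>colour_shift_not_uniform\<close>).
\<close>

lemma colour_eq_iff: "colour m = colour n \<longleftrightarrow> (m \<in> V \<longleftrightarrow> n \<in> V)"
  by (simp add: colour_def)

lemma last_nonzero_digit4_mod:
  assumes "n mod 4 \<noteq> 0"
  shows "last_nonzero_digit4 n = n mod 4"
proof -
  have "(LEAST k. base4_digit n k \<noteq> 0) = 0"
    using assms by (intro Least_eq_0) (simp add: base4_digit_def)
  then show ?thesis
    by (simp add: last_nonzero_digit4_def base4_digit_def)
qed

lemma base4_digit_mult_4: "base4_digit (4 * n) (Suc k) = base4_digit n k"
  by (simp add: base4_digit_def)

lemma nonzero_base4_digit_exists:
  assumes "n > 0"
  shows "\<exists>k. base4_digit n k \<noteq> 0"
  using assms
proof (induction n rule: less_induct)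
  case (less n)
  show ?case
  proof (cases "n mod 4 = 0")
    case True
    then obtain m where m: "n = 4 * m" by (meson mod_0_imp_dvd dvdE)
    then have "m < n" "m > 0" using less.prems by simp_all
    then obtain k where "base4_digit m k \<noteq> 0" using less.IH by blast
    then have "base4_digit n (Suc k) \<noteq> 0" by (simp add: m base4_digit_mult_4)
    then show ?thesis ..
  next
    case False
    then have "base4_digit n 0 \<noteq> 0" by (simp add: base4_digit_def)
    then show ?thesis ..
  qed
qed

text \<open>
  Multiplication by \<open>4\<close> appends a digit \<open>0\<close>, which moves the least index of a non-zero digit
  up by one.  Positivity guarantees that such an index exists.
\<close>
lemma last_nonzero_digit4_mult_4:
  assumes "n > 0"
  shows "last_nonzero_digit4 (4 * n) = last_nonzero_digit4 n"
proof -
  obtain k where "base4_digit n k \<noteq> 0"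
    using nonzero_base4_digit_exists[OF assms] ..
  then have "base4_digit (4 * n) (Suc k) \<noteq> 0" by (simp add: base4_digit_mult_4)
  then have "(LEAST k. base4_digit (4 * n) k \<noteq> 0)
      = Suc (LEAST k. base4_digit (4 * n) (Suc k) \<noteq> 0)"
    by (rule Least_Suc) (simp add: base4_digit_def)
  then show ?thesis
    by (simp add: last_nonzero_digit4_def base4_digit_mult_4)
qed

lemma colour_mult_4: "n > 0 \<Longrightarrow> colour (4 * n) = colour n"
  by (simp add: colour_def V_def last_nonzero_digit4_mult_4)

lemma colour_odd:
  assumes "odd n"
  shows "colour n = 1"
proof -
  have "n mod 4 = 1 \<or> n mod 4 = 3"
    using assms by presburger
  moreover have "n > 0"
    using assms by (rule odd_pos)
  ultimately show ?thesis
    using last_nonzero_digit4_mod[of n] by (auto simp: colour_def V_def)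
qed

lemma colour_double_odd:
  assumes "odd n"
  shows "colour (2 * n) = 0"
proof -
  have "(2 * n) mod 4 = 2"
    using assms by presburger
  then show ?thesis
    using last_nonzero_digit4_mod[of "2 * n"] by (simp add: colour_def V_def)
qed

text \<open>
  Since colours are invariant under multiplication by \<open>4\<close>, the colours of \<open>n\<close> and \<open>2 * n\<close>
  are, in one order or the other, those of an odd number and of its double.
\<close>
lemma colour_double:
  assumes "n > 0"
  shows "colour (2 * n) \<noteq> colour n"
  using assms
proof (induction n rule: less_induct)
  case (less n)
  show ?case
  proof (cases "odd n")
    case True
    then show ?thesis by (simp add: colour_odd colour_double_odd)
  next
    case False
    then obtain m where m: "n = 2 * m" by (auto elim: evenE)
    have "colour (2 * n) = colour m"
      using less.prems colour_mult_4[of m] by (simp add: m)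
    moreover have "colour (2 * m) \<noteq> colour m"
      using less.IH[of m] less.prems m by simp
    ultimately show ?thesis by (simp add: m)
  qed
qed

text \<open>
  There are only two colours, so two shifts that both preserve or both reverse the colour
  cancel.  The path \<open>2 * a\<close>, \<open>3 * a\<close>, \<open>4 * a\<close> thus ends in the colour in which it starts,
  although its end is the double of its start.
\<close>
lemma colour_shift_not_uniform:
  assumes "a > 0"
  shows "\<not> (\<forall>x>0. (colour (x + a) = colour x) = s)"
proof
  assume uniform: "\<forall>x>0. (colour (x + a) = colour x) = s"
  have "(colour (3 * a) = colour (2 * a)) = s" "(colour (4 * a) = colour (3 * a)) = s"
    using assms uniform[rule_format, of "2 * a"] uniform[rule_format, of "3 * a"]
    by simp_all
  then have "colour (4 * a) = colour (2 * a)"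
    unfolding colour_eq_iff by blast
  then show False
    using assms colour_double[of "2 * a"] by simp
qed

theorem theorem4p7:
  shows "\<not> (\<exists>a b :: nat. (a, b) \<noteq> (0, 0) \<and>
    (\<forall>x y :: nat. x > 0 \<and> y > 0 \<longrightarrow>
      parameter_tiling (x + a) (y + b) = parameter_tiling x y))"
proof
  assume "\<exists>a b :: nat. (a, b) \<noteq> (0, 0) \<and>
    (\<forall>x y :: nat. x > 0 \<and> y > 0 \<longrightarrow>
      parameter_tiling (x + a) (y + b) = parameter_tiling x y)"
  then obtain a b :: nat where nonzero: "(a, b) \<noteq> (0, 0)"
    and period: "\<And>x y. x > 0 \<Longrightarrow> y > 0 \<Longrightarrow>
      parameter_tiling (x + a) (y + b) = parameter_tiling x y"
    by blast
  have separated: "(colour (x + a) = colour x) = (colour (y + b) = colour y)"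
    if "x > 0" "y > 0" for x y
  proof -
    have "(colour (x + a) = colour (y + b)) = (colour x = colour y)"
      using period[OF that] unfolding parameter_tiling_def by (metis zero_neq_one)
    then show ?thesis
      unfolding colour_eq_iff by blast
  qed
  \<comment> \<open>Fixing one variable at \<open>1\<close> shows that the other shift acts uniformly.\<close>
  have uniform_a: "\<forall>x>0. (colour (x + a) = colour x) = (colour (1 + b) = colour 1)"
    by (intro allI impI separated zero_less_one)
  have uniform_b: "\<forall>y>0. (colour (y + b) = colour y) = (colour (1 + a) = colour 1)"
    by (intro allI impI separated[symmetric] zero_less_one)
  from nonzero consider "a > 0" | "b > 0" by auto
  then show False
  proof cases
    case 1
    from colour_shift_not_uniform[OF 1] uniform_a show ?thesis by (rule notE)
  next
    case 2
    from colour_shift_not_uniform[OF 2] uniform_b show ?thesis by (rule notE)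
  qed
qed

end
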